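(* Let $\Lambda$ be a non-ordinary acute numerical semigroup with enumeration $\lambda$, conductor $c$, subconductor $c'$ and dominant $d$. Let $$m=\min\{\lambda^{-1}(c+c'-2),\ \lambda^{-1}(2d)\}.$$ Then (1) $\nu_m>\nu_{m+1}$; (2) $\nu_i\leq\nu_{i+1}$ for all $i>m$.
   Context: $\mathbb{N}_0$ is the set of non-negative integers. A numerical semigroup is a subset $\Lambda\subseteq\mathbb{N}_0$ containing $0$, closed under addition, with finite complement in $\mathbb{N}_0$. Elements of $\mathbb{N}_0\setminus\Lambda$ are gaps. The conductor is the unique $c\in\Lambda$ with $c-1\notin\Lambda$ and $c+\mathbb{N}_0\subseteq\Lambda$. The enumeration of $\Lambda$ is the unique increasing bijection $\lambda:\mathbb{N}_0\to\Lambda$, written $\lambda_i=\lambda(i)$. For $i\in\mathbb{N}_0$, $\nu_i=\#\{j\in\mathbb{N}_0\mid\lambda_i-\lambda_j\in\Lambda\}$. $\Lambda$ is ordinary if $\Lambda=\{0\}\cup\{i\in\mathbb{N}_0\mid i\geq c\}$ for some non-negative integer $c$. For $\Lambda\neq\mathbb{N}_0$, the dominant is $d=\lambda_{\lambda^{-1}(c)-1}$ (the largest non-gap smaller than the conductor). Let $g(i)$ be the number of gaps smaller than $\lambda_i$. The subconductor is $c'=\lambda_i$, where $i$ is the smallest integer with $g(i)=g(\lambda^{-1}(d))$. If $\Lambda$ is non-ordinary (in which case $c'>0$), the subdominant is $d'=\lambda_{i-1}$, where $c'=\lambda_i$. $\Lambda$ is acute if it is ordinary, or if it is non-ordinary and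 $c-d\leq c'-d'$. *)

theory Defs
  imports Main "HOL-Library.Infinite_Set"
begin

definition numerical_semigroup :: "nat set \<Rightarrow> bool" where
  "numerical_semigroup \<Lambda> \<longleftrightarrow>
     0 \<in> \<Lambda> \<and> (\<forall>x\<in>\<Lambda>. \<forall>y\<in>\<Lambda>. x + y \<in> \<Lambda>) \<and> finite (- \<Lambda>)"

(* The enumeration of \<Lambda> is Infinite_Set.enumerate: the increasing bijection from nat onto
   an infinite subset of nat. Its inverse is only meaningful on elements of \<Lambda>. *)
definition index_of :: "nat set \<Rightarrow> nat \<Rightarrow> nat" where
  "index_of \<Lambda> = the_inv_into UNIV (enumerate \<Lambda>)"

(* The difference c - 1 is taken in the integers, so that c = 0 for \<Lambda> = UNIV. *)
definition conductor :: "nat set \<Rightarrow> nat" where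
  "conductor \<Lambda> = (THE c. c \<in> \<Lambda> \<and> int c - 1 \<notin> int ` \<Lambda> \<and> (\<forall>n. c + n \<in> \<Lambda>))"

(* Again the difference is an integer: truncated subtraction would make the condition hold
   whenever enumerate \<Lambda> j exceeds enumerate \<Lambda> i. *)
definition nu :: "nat set \<Rightarrow> nat \<Rightarrow> nat" where
  "nu \<Lambda> i = card {j. int (enumerate \<Lambda> i) - int (enumerate \<Lambda> j) \<in> int ` \<Lambda>}"

definition ordinary :: "nat set \<Rightarrow> bool" where
  "ordinary \<Lambda> \<longleftrightarrow> (\<exists>c. \<Lambda> = {0} \<union> {i. i \<ge> c})"

(* Meaningful for \<Lambda> \<noteq> UNIV, where the conductor has positive index. *)
definition dominant :: "nat set \<Rightarrow> nat" where
  "dominant \<Lambda> = enumerate \<Lambda> (index_of \<Lambda> (conductor \<Lambda>) - 1)"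

definition gaps_below :: "nat set \<Rightarrow> nat \<Rightarrow> nat" where
  "gaps_below \<Lambda> i = card {x. x \<notin> \<Lambda> \<and> x < enumerate \<Lambda> i}"

definition subconductor :: "nat set \<Rightarrow> nat" where
  "subconductor \<Lambda> =
     enumerate \<Lambda> (LEAST i. gaps_below \<Lambda> i = gaps_below \<Lambda> (index_of \<Lambda> (dominant \<Lambda>)))"

(* Meaningful for non-ordinary \<Lambda>, where the subconductor is positive. *)
definition subdominant :: "nat set \<Rightarrow> nat" where
  "subdominant \<Lambda> = enumerate \<Lambda> (index_of \<Lambda> (subconductor \<Lambda>) - 1)"

definition acute :: "nat set \<Rightarrow> bool" where
  "acute \<Lambda> \<longleftrightarrow> ordinary \<Lambda> \<or>
     (\<not> ordinary \<Lambda> \<and>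
      int (conductor \<Lambda>) - int (dominant \<Lambda>) \<le> int (subconductor \<Lambda>) - int (subdominant \<Lambda>))"

end

theory Submission
  imports Defs
begin

text \<open>
  Let \<open>N x\<close> count the \<open>y\<close> in \<open>\<Lambda>\<close> with \<open>x - y\<close> in \<open>\<Lambda>\<close>, and let \<open>D x\<close> count the gaps \<open>y\<close> for which
  \<open>x - y\<close> is a gap as well. By inclusion-exclusion \<open>N x = x + 1 - 2 g + D x\<close> for \<open>x \<ge> c\<close>, where \<open>g\<close> is
  the genus, so it suffices to follow \<open>D\<close>. For \<open>x \<ge> min (c + c' - 2) (2 * d)\<close> no two gaps below
  \<open>c'\<close> sum to \<open>x\<close>, and acuteness makes all numbers of \<open>{x - c<..<c'}\<close> gaps. Thus \<open>D x\<close>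
  is the sum of a tent function of slope 1 starting at \<open>2 * d + 1\<close>, coming from pairs of gaps above
  \<open>d\<close>, and of twice the truncated difference \<open>c + c' - 1 - x\<close>, coming from the mixed pairs.
\<close>

section \<open>Enumeration of an infinite set and its inverse\<close>

lemma numerical_semigroup_infinite:
  assumes "numerical_semigroup \<Lambda>"
  shows "infinite \<Lambda>"
  using assms unfolding numerical_semigroup_def
  by (metis Compl_partition2 finite_UnI infinite_UNIV_nat)

lemma index_of_enumerate:
  assumes "infinite \<Lambda>"
  shows "index_of \<Lambda> (enumerate \<Lambda> i) = i"
  unfolding index_of_def
  using inj_enumerate[OF assms] by (simp add: the_inv_f_f)

lemma enumerate_index_of:
  assumes "infinite \<Lambda>" and "x \<in> \<Lambda>"
  shows "enumerate \<Lambda> (index_of \<Lambda> x) = x"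
  using assms by (metis enumerate_Ex index_of_enumerate)

text \<open>As the inverse of a strictly increasing map, \<open>index_of\<close> is monotone on
  \<open>\<Lambda>\<close>. This turns \<open>m\<close> into the index of a single number.\<close>

lemma min_index_of:
  assumes "infinite \<Lambda>" and "x \<in> \<Lambda>" and "y \<in> \<Lambda>"
  shows "min (index_of \<Lambda> x) (index_of \<Lambda> y) = index_of \<Lambda> (min x y)"
proof -
  have "index_of \<Lambda> x \<le> index_of \<Lambda> y \<longleftrightarrow> x \<le> y"
    using enumerate_mono_le_iff[OF assms(1), of "index_of \<Lambda> x" "index_of \<Lambda> y"]
    by (simp add: enumerate_index_of assms)
  then show ?thesis by (simp add: min_def)
qed

lemma not_mem_between_enumerate:
  fixes \<Lambda> :: "nat set"
  assumes "infinite \<Lambda>" and "enumerate \<Lambda> i < x" and "x < enumerate \<Lambda> (Suc i)"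
  shows "x \<notin> \<Lambda>"
proof
  assume "x \<in> \<Lambda>"
  then obtain j where "x = enumerate \<Lambda> j"
    using enumerate_Ex[OF assms(1)] by blast
  then have "i < j" "j < Suc i" using assms by simp_all
  then show False by simp
qed

lemma enumerate_zero_eq:
  assumes "(0::nat) \<in> \<Lambda>"
  shows "enumerate \<Lambda> 0 = 0"
  using assms by (simp add: enumerate_0)

lemma enumerate_Suc_eq_Suc:
  assumes "infinite \<Lambda>" and "Suc (enumerate \<Lambda> i) \<in> \<Lambda>"
  shows "enumerate \<Lambda> (Suc i) = Suc (enumerate \<Lambda> i)"
proof -
  have "enumerate \<Lambda> i < enumerate \<Lambda> (Suc i)"
    using assms(1) by (simp add: enumerate_step)
  moreover have "\<not> Suc (enumerate \<Lambda> i) < enumerate \<Lambda> (Suc i)"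
    using not_mem_between_enumerate assms by blast
  ultimately show ?thesis by linarith
qed

section \<open>From \<open>nu\<close> to pairs of gaps\<close>

text \<open>Reindexing along \<open>enumerate\<close> trades indices for elements; the bound on
  \<open>y\<close> keeps truncated subtraction faithful to the integer one.\<close>

lemma nu_eq_card:
  assumes "infinite \<Lambda>"
  shows "nu \<Lambda> i = card {y \<in> \<Lambda>. y \<le> enumerate \<Lambda> i \<and> enumerate \<Lambda> i - y \<in> \<Lambda>}"
proof -
  let ?x = "enumerate \<Lambda> i"
  have iff: "int a - int b \<in> int ` \<Lambda> \<longleftrightarrow> b \<le> a \<and> a - b \<in> \<Lambda>" for a b
  proof
    assume "int a - int b \<in> int ` \<Lambda>"
    then obtain z where "z \<in> \<Lambda>" "int a - int b = int z" by auto
    moreover from this have "a - b = z" "b \<le> a" by linarith+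
    ultimately show "b \<le> a \<and> a - b \<in> \<Lambda>" by simp
  next
    assume "b \<le> a \<and> a - b \<in> \<Lambda>"
    then show "int a - int b \<in> int ` \<Lambda>" by (auto simp flip: of_nat_diff)
  qed
  have J: "{j. int ?x - int (enumerate \<Lambda> j) \<in> int ` \<Lambda>} = {j. enumerate \<Lambda> j \<le> ?x \<and> ?x - enumerate \<Lambda> j \<in> \<Lambda>}"
    (is "_ = ?J")
    unfolding iff ..
  have "bij_betw (enumerate \<Lambda>) ?J {y \<in> \<Lambda>. y \<le> ?x \<and> ?x - y \<in> \<Lambda>}"
  proof (rule bij_betw_imageI)
    show "inj_on (enumerate \<Lambda>) ?J"
      using inj_enumerate[OF assms] by (rule inj_on_subset) simp
    show "enumerate \<Lambda> ` ?J = {y \<in> \<Lambda>. y \<le> ?x \<and> ?x - y \<in> \<Lambda>}"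
    proof (intro subset_antisym subsetI)
      fix y assume y: "y \<in> {y \<in> \<Lambda>. y \<le> ?x \<and> ?x - y \<in> \<Lambda>}"
      then have "enumerate \<Lambda> (index_of \<Lambda> y) = y" using assms by (simp add: enumerate_index_of)
      with y show "y \<in> enumerate \<Lambda> ` ?J"
        by (intro image_eqI[of _ _ "index_of \<Lambda> y"]) simp_all
    next
      fix y assume "y \<in> enumerate \<Lambda> ` ?J"
      then obtain j where "y = enumerate \<Lambda> j" "j \<in> ?J" by (rule imageE)
      then show "y \<in> {y \<in> \<Lambda>. y \<le> ?x \<and> ?x - y \<in> \<Lambda>}"
        using enumerate_in_set[OF assms, of j] by simp
    qed
  qed
  then show ?thesis
    unfolding nu_def J by (rule bij_betw_same_card)
qed

text \<open>Within \<open>{..x}\<close>, the set counted on the left is the complement of the union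
  of the gaps and their reflections \<open>x - y\<close>. As \<open>x\<close> bounds every gap, both
  families have \<open>card (- \<Lambda>)\<close> members; they meet in the set counted on the
  right.\<close>

lemma card_summands_plus_card_gaps:
  fixes \<Lambda> :: "nat set"
  assumes fin: "finite (- \<Lambda>)" and big: "\<And>y. y \<notin> \<Lambda> \<Longrightarrow> y \<le> x"
  shows "card {y \<in> \<Lambda>. y \<le> x \<and> x - y \<in> \<Lambda>} + 2 * card (- \<Lambda>)
    = x + 1 + card {y. y \<le> x \<and> y \<notin> \<Lambda> \<and> x - y \<notin> \<Lambda>}"
proof -
  let ?N = "{y \<in> \<Lambda>. y \<le> x \<and> x - y \<in> \<Lambda>}" and ?B = "{y. y \<le> x \<and> x - y \<notin> \<Lambda>}"
  have "?B = (\<lambda>y. x - y) ` (- \<Lambda>)"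
    using big by (force simp: image_iff)
  moreover have "inj_on (\<lambda>y. x - y) (- \<Lambda>)"
    using big by (intro inj_onI) (metis ComplD diff_diff_cancel)
  ultimately have B: "card ?B = card (- \<Lambda>)"
    by (simp add: card_image)
  have "- \<Lambda> \<inter> ?B = {y. y \<le> x \<and> y \<notin> \<Lambda> \<and> x - y \<notin> \<Lambda>}" by auto
  then have inc: "2 * card (- \<Lambda>) = card (- \<Lambda> \<union> ?B) + card {y. y \<le> x \<and> y \<notin> \<Lambda> \<and> x - y \<notin> \<Lambda>}"
    using card_Un_Int[OF fin, of ?B] B by simp
  have "{..x} = ?N \<union> (- \<Lambda> \<union> ?B)" using big by auto
  then have "x + 1 = card (?N \<union> (- \<Lambda> \<union> ?B))" by (metis Suc_eq_plus1 card_atMost)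
  also have "\<dots> = card ?N + card (- \<Lambda> \<union> ?B)"
    using fin by (intro card_Un_disjoint) auto
  finally show ?thesis using inc by simp
qed

section \<open>Conductor, dominant and subconductor\<close>

lemma conductor_props:
  assumes ns: "numerical_semigroup \<Lambda>" and "\<Lambda> \<noteq> UNIV"
  shows "conductor \<Lambda> > 0" and "conductor \<Lambda> - 1 \<notin> \<Lambda>" and "conductor \<Lambda> \<le> n \<Longrightarrow> n \<in> \<Lambda>"
proof -
  \<comment> \<open>The largest gap; the conductor is its successor.\<close>
  define f where "f = Max (- \<Lambda>)"
  have fin: "finite (- \<Lambda>)" using ns by (simp add: numerical_semigroup_def)
  have above: "y \<in> \<Lambda>" if "y > f" for y
    using Max_ge[OF fin, of y] that unfolding f_def by fastforce
  have f: "f \<notin> \<Lambda>" using fin assms(2) Max_in[of "- \<Lambda>"] unfolding f_def by auto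
  have "conductor \<Lambda> = Suc f"
    unfolding conductor_def
  proof (rule the_equality)
    show "Suc f \<in> \<Lambda> \<and> int (Suc f) - 1 \<notin> int ` \<Lambda> \<and> (\<forall>n. Suc f + n \<in> \<Lambda>)"
      using f above by auto
  next
    fix c assume c: "c \<in> \<Lambda> \<and> int c - 1 \<notin> int ` \<Lambda> \<and> (\<forall>n. c + n \<in> \<Lambda>)"
    have "c > f" using c f by (metis le_add_diff_inverse not_le)
    moreover have "c - 1 \<notin> \<Lambda>"
    proof
      assume "c - 1 \<in> \<Lambda>"
      then have "int (c - 1) \<in> int ` \<Lambda>" by (rule imageI)
      with c \<open>c > f\<close> show False by (simp add: of_nat_diff)
    qed
    then have "\<not> c - 1 > f" using above by blast
    ultimately show "c = Suc f" by linarith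
  qed
  then show "conductor \<Lambda> > 0" "conductor \<Lambda> - 1 \<notin> \<Lambda>" "conductor \<Lambda> \<le> n \<Longrightarrow> n \<in> \<Lambda>"
    using f above by auto
qed

lemma dominant_props:
  assumes ns: "numerical_semigroup \<Lambda>" and no: "\<not> ordinary \<Lambda>"
  shows "0 < dominant \<Lambda>" and "dominant \<Lambda> \<in> \<Lambda>" and "dominant \<Lambda> < conductor \<Lambda>"
    and "\<lbrakk>dominant \<Lambda> < y; y < conductor \<Lambda>\<rbrakk> \<Longrightarrow> y \<notin> \<Lambda>"
proof -
  have inf: "infinite \<Lambda>" using ns by (rule numerical_semigroup_infinite)
  have zero: "0 \<in> \<Lambda>" using ns by (simp add: numerical_semigroup_def)
  have "\<Lambda> \<noteq> UNIV" using no unfolding ordinary_def by auto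
  note c = conductor_props[OF ns this]
  define k where "k = index_of \<Lambda> (conductor \<Lambda>)"
  have k: "enumerate \<Lambda> k = conductor \<Lambda>"
    unfolding k_def using c inf by (simp add: enumerate_index_of)
  have "k \<noteq> 0" using k c(1) enumerate_zero_eq[OF zero] by (metis less_irrefl)
  then have d: "dominant \<Lambda> = enumerate \<Lambda> (k - 1)" and Sk: "Suc (k - 1) = k"
    unfolding dominant_def k_def by auto
  show mem: "dominant \<Lambda> \<in> \<Lambda>" unfolding d using inf by (rule enumerate_in_set)
  show lt: "dominant \<Lambda> < conductor \<Lambda>"
    unfolding d k[symmetric] using inf \<open>k \<noteq> 0\<close> by (simp add: enumerate_mono)
  show btw: "y \<notin> \<Lambda>" if "dominant \<Lambda> < y" "y < conductor \<Lambda>" for y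
    using not_mem_between_enumerate[OF inf, of "k - 1" y] that unfolding d Sk k by simp
  \<comment> \<open>Otherwise \<open>0\<close> is the only element below the conductor, which makes
    \<open>\<Lambda>\<close> ordinary.\<close>
  show "0 < dominant \<Lambda>"
  proof (rule ccontr)
    assume "\<not> 0 < dominant \<Lambda>"
    then have "y \<in> \<Lambda> \<longleftrightarrow> y = 0 \<or> conductor \<Lambda> \<le> y" for y
      using btw[of y] zero c(3)[of y] by (cases "y = 0"; cases "conductor \<Lambda> \<le> y") auto
    then have "\<Lambda> = {0} \<union> {i. i \<ge> conductor \<Lambda>}" by blast
    with no show False unfolding ordinary_def by blast
  qed
qed

text \<open>Equal gap counts at two indices mean that no gap lies between the two elements, so the
  \<open>LEAST\<close> selects the start of the run of consecutive elements that ends at the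
  dominant.\<close>

lemma subconductor_props:
  assumes ns: "numerical_semigroup \<Lambda>" and no: "\<not> ordinary \<Lambda>"
  shows "2 \<le> subconductor \<Lambda>" and "subconductor \<Lambda> \<le> dominant \<Lambda>"
    and "subconductor \<Lambda> - 1 \<notin> \<Lambda>"
    and "\<lbrakk>subconductor \<Lambda> \<le> y; y \<le> dominant \<Lambda>\<rbrakk> \<Longrightarrow> y \<in> \<Lambda>"
    and "\<lbrakk>subdominant \<Lambda> < y; y < subconductor \<Lambda>\<rbrakk> \<Longrightarrow> y \<notin> \<Lambda>"
proof -
  have inf: "infinite \<Lambda>" using ns by (rule numerical_semigroup_infinite)
  have zero: "0 \<in> \<Lambda>" and add: "\<And>x y. x \<in> \<Lambda> \<Longrightarrow> y \<in> \<Lambda> \<Longrightarrow> x + y \<in> \<Lambda>"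
    using ns by (auto simp: numerical_semigroup_def)
  have "\<Lambda> \<noteq> UNIV" using no unfolding ordinary_def by auto
  note d = dominant_props[OF ns no]
  define k where "k = index_of \<Lambda> (dominant \<Lambda>)"
  have k: "enumerate \<Lambda> k = dominant \<Lambda>"
    unfolding k_def using d inf by (simp add: enumerate_index_of)
  define i where "i = (LEAST i. gaps_below \<Lambda> i = gaps_below \<Lambda> k)"
  have i: "gaps_below \<Lambda> i = gaps_below \<Lambda> k"
    unfolding i_def by (rule LeastI) simp
  have "i \<le> k" unfolding i_def by (rule Least_le) simp
  have c': "subconductor \<Lambda> = enumerate \<Lambda> i"
    unfolding subconductor_def i_def k_def ..
  show le: "subconductor \<Lambda> \<le> dominant \<Lambda>"
    unfolding c' k[symmetric] using \<open>i \<le> k\<close> inf by simp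
  show int: "y \<in> \<Lambda>" if y: "subconductor \<Lambda> \<le> y" "y \<le> dominant \<Lambda>" for y
  proof (rule ccontr)
    assume "y \<notin> \<Lambda>"
    \<comment> \<open>Nested finite sets of equal size coincide.\<close>
    have "{x. x \<notin> \<Lambda> \<and> x < enumerate \<Lambda> i} = {x. x \<notin> \<Lambda> \<and> x < enumerate \<Lambda> k}"
      using i le unfolding gaps_below_def c' k by (intro card_subset_eq) auto
    moreover have "y < enumerate \<Lambda> k"
      using d(2) \<open>y \<notin> \<Lambda>\<close> y(2) unfolding k by (metis nat_less_le)
    ultimately have "y < enumerate \<Lambda> i" using \<open>y \<notin> \<Lambda>\<close> by blast
    with y(1) show False unfolding c' by simp
  qed
  \<comment> \<open>Needed for \<open>i - 1\<close> to be a true predecessor. Otherwise the run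
    would start at \<open>0\<close> and contain \<open>1\<close>, which generates
    everything.\<close>
  have "i \<noteq> 0"
  proof
    assume "i = 0"
    then have "subconductor \<Lambda> = 0" using c' enumerate_zero_eq[OF zero] by simp
    then have "1 \<in> \<Lambda>" using int[of 1] d(1) by simp
    then have "n \<in> \<Lambda>" for n
      by (induction n) (use zero in simp, metis add Suc_eq_plus1)
    with \<open>\<Lambda> \<noteq> UNIV\<close> show False by auto
  qed
  then have Si: "Suc (i - 1) = i" by simp
  have d': "subdominant \<Lambda> = enumerate \<Lambda> (i - 1)"
    unfolding subdominant_def c' index_of_enumerate[OF inf] ..
  show btw: "y \<notin> \<Lambda>" if "subdominant \<Lambda> < y" "y < subconductor \<Lambda>" for y
    using not_mem_between_enumerate[OF inf, of "i - 1" y] that unfolding d' Si c' by simp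
  have lt: "subdominant \<Lambda> < subconductor \<Lambda>"
    unfolding d' c' using inf \<open>i \<noteq> 0\<close> by (simp add: enumerate_mono)
  show gap: "subconductor \<Lambda> - 1 \<notin> \<Lambda>"
  proof
    assume mem: "subconductor \<Lambda> - 1 \<in> \<Lambda>"
    then have eq: "subconductor \<Lambda> = Suc (subdominant \<Lambda>)"
      using btw[of "subconductor \<Lambda> - 1"] lt by linarith
    \<comment> \<open>With no gap just before the subconductor, the previous index has the same gap
      count, against the minimality of \<open>i\<close>.\<close>
    then have "gaps_below \<Lambda> (i - 1) = gaps_below \<Lambda> i"
      using mem unfolding gaps_below_def c'[symmetric] d'[symmetric]
      by (intro arg_cong[where f = card]) (auto simp: less_Suc_eq)
    then have "i \<le> i - 1" unfolding i unfolding i_def by (rule Least_le)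
    with \<open>i \<noteq> 0\<close> show False by simp
  qed
  have "subconductor \<Lambda> \<noteq> 1" using gap zero by auto
  with lt show "2 \<le> subconductor \<Lambda>" by linarith
qed

section \<open>Pairs of gaps with a given sum\<close>

text \<open>Gaps lie below \<open>c'\<close> or strictly between \<open>d\<close> and
  \<open>c\<close>. Two lower ones sum to at most \<open>2 * c' - 2\<close>, which is less than
  \<open>x\<close>, so a pair is lower-upper (\<open>?L\<close>), upper-upper (\<open>?T\<close>) or
  upper-lower (\<open>?R\<close>).\<close>

lemma card_gap_pairs:
  fixes c c' d d' x :: nat
  assumes c: "\<And>y. c \<le> y \<Longrightarrow> y \<in> \<Lambda>" "c - 1 \<notin> \<Lambda>"
    and d: "d < c" "\<And>y. \<lbrakk>d < y; y < c\<rbrakk> \<Longrightarrow> y \<notin> \<Lambda>"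
    and c': "2 \<le> c'" "c' \<le> d" "c' - 1 \<notin> \<Lambda>" "\<And>y. \<lbrakk>c' \<le> y; y \<le> d\<rbrakk> \<Longrightarrow> y \<in> \<Lambda>"
    and d': "\<And>y. \<lbrakk>d' < y; y < c'\<rbrakk> \<Longrightarrow> y \<notin> \<Lambda>"
    and acute: "c + d' \<le> c' + d"
    and x: "min (c + c' - 2) (2 * d) \<le> x"
  shows "card {y. y \<le> x \<and> y \<notin> \<Lambda> \<and> x - y \<notin> \<Lambda>}
    = 2 * (c + c' - 1 - x) + (min c (x - d) - Suc (max d (x - c)))"
proof -
  let ?L = "{x - c<..<c'}" and ?T = "{max d (x - c)<..<min c (x - d)}" and ?R = "{x - c'<..<c}"
  \<comment> \<open>By acuteness, \<open>2 * d \<ge> c' + d \<ge> c + d' \<ge> c\<close>.\<close>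
  have cx: "c \<le> x" using x c'(1,2) acute by linarith
  have gapE: "y < c' \<or> d < y \<and> y < c" if "y \<notin> \<Lambda>" for y
    using that c(1)[of y] c'(4)[of y] by linarith
  have pair: "y \<notin> \<Lambda> \<and> x - y \<notin> \<Lambda>" if y: "y \<in> ?L" for y
  proof (cases "2 * d \<le> x")
    case True
    \<comment> \<open>Acuteness and \<open>c' \<le> d\<close> give
      \<open>c + d' \<le> 2 * d \<le> x\<close>, hence \<open>d' \<le> x - c < y\<close>; and
      \<open>y < c' \<le> d\<close> forces \<open>x - y > d\<close>.\<close>
    have "d' < y" "d < x - y" "x - y < c"
      using y True acute c'(2) cx by auto
    then show ?thesis using d'[of y] d(2)[of "x - y"] y by auto
  next
    case False
    \<comment> \<open>Now \<open>x \<ge> c + c' - 2\<close>, so \<open>?L\<close> has room for one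
      point only.\<close>
    have "y = c' - 1" "x - y = c - 1"
      using False x y c'(1) cx by auto
    then show ?thesis using c(2) c'(3) by simp
  qed
  have "{y. y \<le> x \<and> y \<notin> \<Lambda> \<and> x - y \<notin> \<Lambda>} = ?L \<union> ?T \<union> ?R"
  proof (intro subset_antisym subsetI)
    fix y assume "y \<in> {y. y \<le> x \<and> y \<notin> \<Lambda> \<and> x - y \<notin> \<Lambda>}"
    then have "y \<le> x" "y < c' \<or> d < y \<and> y < c" "x - y < c' \<or> d < x - y \<and> x - y < c"
      using gapE by auto
    then show "y \<in> ?L \<union> ?T \<union> ?R" using x cx c'(1,2) d(1) by auto
  next
    fix y assume "y \<in> ?L \<union> ?T \<union> ?R"
    then consider "y \<in> ?L" | "y \<in> ?T" | "y \<in> ?R" by blast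
    then show "y \<in> {y. y \<le> x \<and> y \<notin> \<Lambda> \<and> x - y \<notin> \<Lambda>}"
    proof cases
      case 1
      then show ?thesis using pair[OF 1] c'(2) d(1) cx by auto
    next
      case 2
      then have "y \<notin> \<Lambda>" "x - y \<notin> \<Lambda>" by (intro d(2); auto)+
      then show ?thesis using 2 by auto
    next
      case 3
      \<comment> \<open>The reflection \<open>x - y\<close> carries \<open>?R\<close> into
        \<open>?L\<close>.\<close>
      then have "x - y \<in> ?L" "x - (x - y) = y" using cx c'(2) d(1) by auto
      then show ?thesis using pair[of "x - y"] 3 cx by auto
    qed
  qed
  moreover have "?L \<inter> ?T = {}" "(?L \<union> ?T) \<inter> ?R = {}"
    using x c'(1,2) d(1) cx by auto
  then have "card (?L \<union> ?T \<union> ?R) = card ?L + card ?T + card ?R"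
    by (simp add: card_Un_disjoint)
  moreover have "card ?L = c + c' - 1 - x" "card ?R = c + c' - 1 - x"
    using cx c'(2) d(1) by simp_all
  ultimately show ?thesis by simp
qed

section \<open>Comparison of consecutive values of \<open>nu\<close>\<close>

theorem theorem6p3:
  fixes \<Lambda> :: "nat set" and c c' d m :: nat
  assumes "numerical_semigroup \<Lambda>"
    and "\<not> ordinary \<Lambda>"
    and "acute \<Lambda>"
    and "c = conductor \<Lambda>"
    and "c' = subconductor \<Lambda>"
    and "d = dominant \<Lambda>"
    and "m = min (index_of \<Lambda> (c + c' - 2)) (index_of \<Lambda> (2 * d))"
  shows "nu \<Lambda> m > nu \<Lambda> (m + 1) \<and> (\<forall>i>m. nu \<Lambda> i \<le> nu \<Lambda> (i + 1))"
proof -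
  have inf: "infinite \<Lambda>" using assms(1) by (rule numerical_semigroup_infinite)
  have fin: "finite (- \<Lambda>)" using assms(1) by (simp add: numerical_semigroup_def)
  have "\<Lambda> \<noteq> UNIV" using assms(2) unfolding ordinary_def by auto
  note c = conductor_props[OF assms(1) this, folded assms(4)]
    and d = dominant_props[OF assms(1,2), folded assms(4,6)]
    and c' = subconductor_props[OF assms(1,2), folded assms(5,6)]
  define d' where "d' = subdominant \<Lambda>"
  have acute: "c + d' \<le> c' + d"
    using assms(2,3) unfolding acute_def assms(4-6) d'_def by linarith
  define M where "M = min (c + c' - 2) (2 * d)"
  have cM: "c \<le> M" unfolding M_def using c'(1,2) acute by linarith
  \<comment> \<open>Both candidates are at least \<open>c\<close>, hence in
    \<open>\<Lambda>\<close>, where \<open>index_of\<close> is meaningful.\<close>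
  have "enumerate \<Lambda> m = M"
    using assms(7) cM c(3) inf unfolding M_def by (simp add: min_index_of enumerate_index_of)
  \<comment> \<open>\<open>S\<close> is the size of each mixed block. \<open>T\<close> is the tent:
    it rises from \<open>2 * d + 1\<close> to \<open>c + d\<close>, then falls; truncation makes it
    \<open>0\<close> elsewhere.\<close>
  define S where "S x = c + c' - 1 - x" for x
  define T where "T x = min c (x - d) - Suc (max d (x - c))" for x
  have nu: "nu \<Lambda> i + 2 * card (- \<Lambda>) = x + 1 + (2 * S x + T x)"
    if x: "enumerate \<Lambda> i = x" "M \<le> x" for i x
  proof -
    have "y \<le> x" if "y \<notin> \<Lambda>" for y
      using that c(3)[of y] x cM by linarith
    then have "nu \<Lambda> i + 2 * card (- \<Lambda>) = x + 1 + card {y. y \<le> x \<and> y \<notin> \<Lambda> \<and> x - y \<notin> \<Lambda>}"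
      unfolding nu_eq_card[OF inf] x(1) by (rule card_summands_plus_card_gaps[OF fin])
    also have "card {y. y \<le> x \<and> y \<notin> \<Lambda> \<and> x - y \<notin> \<Lambda>} = 2 * S x + T x"
      unfolding S_def T_def by (rule card_gap_pairs[of c \<Lambda> d c' d' x])
        (use c d c' acute x in \<open>auto simp: d'_def M_def\<close>)
    finally show ?thesis .
  qed
  have next_x: "enumerate \<Lambda> (i + 1) = enumerate \<Lambda> i + 1" if "M \<le> enumerate \<Lambda> i" for i
    using enumerate_Suc_eq_Suc[OF inf, of i] c(3) that cM by simp
  have "M \<le> c + c' - 2" "M \<le> 2 * d" unfolding M_def by simp_all
  \<comment> \<open>The tent has not left \<open>0\<close> at \<open>M + 1 \<le> 2 * d + 1\<close>,
    so the loss of 2 from \<open>2 * S\<close> outweighs the gain of 1 from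
    \<open>x + 1\<close>.\<close>
  then have "T M = 0" "T (M + 1) = 0" "S M = S (M + 1) + 1"
    using c'(1) unfolding S_def T_def by linarith+
  then have "nu \<Lambda> (m + 1) < nu \<Lambda> m"
    using nu[of m M] nu[of "m + 1" "M + 1"] next_x[of m] \<open>enumerate \<Lambda> m = M\<close> by simp
  moreover have "nu \<Lambda> i \<le> nu \<Lambda> (i + 1)" if "i > m" for i
  proof -
    define x where "x = enumerate \<Lambda> i"
    have x: "M < x"
      using enumerate_mono[OF that inf] \<open>enumerate \<Lambda> m = M\<close> unfolding x_def by simp
    \<comment> \<open>The term \<open>x + 1\<close> in \<open>nu\<close> gains 1 per step, so a loss
      of 1 here is affordable.\<close>
    have "2 * S x + T x \<le> 2 * S (x + 1) + T (x + 1) + 1"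
    proof (cases "x \<le> c + c' - 2")
      case True
      \<comment> \<open>Since \<open>M < x \<le> c + c' - 2\<close>, the minimum \<open>M\<close> is
        \<open>2 * d\<close>. The tent is still rising, because \<open>c' \<le> d\<close>, and makes
        up for half of the loss from \<open>2 * S\<close>.\<close>
      then have "2 * d < x" "x + 1 < c + d"
        using x c'(1,2) unfolding M_def by linarith+
      then have "T x = x - d - Suc d" "T (x + 1) = x + 1 - d - Suc d"
        unfolding T_def by simp_all
      moreover have "S x = S (x + 1) + 1"
        using True c'(1) unfolding S_def by linarith
      ultimately show ?thesis using \<open>2 * d < x\<close> by linarith
    next
      case False
      then have "S x = 0" unfolding S_def by linarith
      moreover have "T x \<le> T (x + 1) + 1"
      \<comment> \<open>The peak of the tent is at \<open>c + d\<close>; even beyond it the slope is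
        at least -1.\<close>
      proof (cases "c + d \<le> x")
        case True
        then have "T x = c - Suc (x - c)" "T (x + 1) = c - Suc (x + 1 - c)"
          unfolding T_def by simp_all
        then show ?thesis using x cM by linarith
      next
        case False
        then have "T x = x - d - Suc d" "T (x + 1) = x + 1 - d - Suc d"
          unfolding T_def by simp_all
        then show ?thesis by linarith
      qed
      ultimately show ?thesis by simp
    qed
    then show ?thesis
      using nu[of i x] nu[of "i + 1" "x + 1"] next_x[of i] x unfolding x_def[symmetric] by simp
  qed
  ultimately show ?thesis by blast
qed

end
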